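(* Let $k>1$ and $\ell\leq k$ be integers. Assume that for any integer $s>0$ there is a $k$-tree such that for every $\ell$-local queue layout of it, there is a $k$-clique with at least $s$ non-nesting children. Then there is a $k$-tree with local queue number at least $\ell+1$.
   Context: Graphs are finite, simple and undirected. Given a linear ordering $\prec$ of the vertex set, two edges $uv$ and $xy$ nest if $u \prec x \prec y \prec v$ or $x \prec u \prec v \prec y$ (for the endpoints named suitably). A queue is a set of edges no two of which nest. A queue layout of $G$ consists of a linear ordering $\prec$ of $V(G)$ and a partition of $E(G)$ into queues; it is $\ell$-local if every vertex has incident edges in at most $\ell$ queues (the number of queues being arbitrary). The local queue number of $G$ is the smallest $\ell$ such that $G$ has an $\ell$-local queue layout. A $k$-tree is a $(k+1)$-clique or is obtained from a smaller $k$-tree by choosing a clique $C$ of size $k$ and adding a new vertex $u$ adjacent to exactly the vertices of $C$. Fixing a construction ordering of the $k$-tree, $u$ is called a child of $C$ and $C$ the parent clique of $u$. With respect to a vertex ordering $\prec$, a child $u$ of $C$ is nesting if it is placed below its parent clique, i.e. if $c\prec u\prec c'$ for some $c,c'\in C$, and non-nesting otherwise, i.e. if $u$ lies to the left or to the right of all vertices of $C$. Each $k$-tree in the hypothesis comes with a fixed construction ordering. *)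

theory Defs
  imports "HOL-Library.Ramsey" "HOL-Library.Disjoint_Sets"
begin

definition simple_graph :: "'a set \<Rightarrow> 'a set set \<Rightarrow> bool" where
  "simple_graph V E \<longleftrightarrow> finite V \<and> E \<subseteq> nsets V 2"

text \<open>Vertex orderings are strict linear orders, given as relations: \<open>(u, v) \<in> lt\<close> means that
  \<open>u\<close> precedes \<open>v\<close>.\<close>

definition nest :: "'a rel \<Rightarrow> 'a set \<Rightarrow> 'a set \<Rightarrow> bool" where
  "nest lt e f \<longleftrightarrow> (\<exists>u v x y. e = {u, v} \<and> f = {x, y} \<and>
     ((u, x) \<in> lt \<and> (x, y) \<in> lt \<and> (y, v) \<in> lt \<or>
      (x, u) \<in> lt \<and> (u, v) \<in> lt \<and> (v, y) \<in> lt))"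

definition queue :: "'a rel \<Rightarrow> 'a set set \<Rightarrow> bool" where
  "queue lt Q \<longleftrightarrow> (\<forall>e\<in>Q. \<forall>f\<in>Q. \<not> nest lt e f)"

definition queue_layout :: "'a set \<Rightarrow> 'a set set \<Rightarrow> 'a rel \<Rightarrow> 'a set set set \<Rightarrow> bool" where
  "queue_layout V E lt P \<longleftrightarrow>
     strict_linear_order_on V lt \<and> partition_on E P \<and> (\<forall>Q\<in>P. queue lt Q)"

definition local_queue_layout ::
    "int \<Rightarrow> 'a set \<Rightarrow> 'a set set \<Rightarrow> 'a rel \<Rightarrow> 'a set set set \<Rightarrow> bool" where
  "local_queue_layout l V E lt P \<longleftrightarrow>
     queue_layout V E lt P \<and> (\<forall>v\<in>V. int (card {Q \<in> P. \<exists>e\<in>Q. v \<in> e}) \<le> l)"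

definition local_queue_number :: "'a set \<Rightarrow> 'a set set \<Rightarrow> nat" where
  "local_queue_number V E = (LEAST l. \<exists>lt P. local_queue_layout (int l) V E lt P)"

text \<open>\<open>ktree_construction k V E cs\<close>: the graph with vertex set \<open>V\<close> and edge set \<open>E\<close> is obtained
  from a clique on \<open>k + 1\<close> vertices by successively adding the vertices listed in \<open>cs\<close>, each
  paired with its parent clique. The vertices of the initial clique have no parent clique.\<close>

inductive ktree_construction ::
    "nat \<Rightarrow> 'a set \<Rightarrow> 'a set set \<Rightarrow> ('a \<times> 'a set) list \<Rightarrow> bool" for k where
  initial: "finite V \<Longrightarrow> card V = k + 1 \<Longrightarrow> ktree_construction k V (nsets V 2) []"
| add_vertex: "ktree_construction k V E cs \<Longrightarrow> C \<subseteq> V \<Longrightarrow> card C = k \<Longrightarrow> clique C E \<Longrightarrow> u \<notin> V \<Longrightarrow>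
    ktree_construction k (insert u V) (E \<union> {{u, c} | c. c \<in> C}) (cs @ [(u, C)])"

definition k_tree :: "nat \<Rightarrow> 'a set \<Rightarrow> 'a set set \<Rightarrow> bool" where
  "k_tree k V E \<longleftrightarrow> (\<exists>cs. ktree_construction k V E cs)"

definition children :: "('a \<times> 'a set) list \<Rightarrow> 'a set \<Rightarrow> 'a set" where
  "children cs C = {u. (u, C) \<in> set cs}"

definition nesting :: "'a rel \<Rightarrow> 'a set \<Rightarrow> 'a \<Rightarrow> bool" where
  "nesting lt C u \<longleftrightarrow> (\<exists>c\<in>C. \<exists>c'\<in>C. (c, u) \<in> lt \<and> (u, c') \<in> lt)"

definition nonnesting_children ::
    "'a rel \<Rightarrow> ('a \<times> 'a set) list \<Rightarrow> 'a set \<Rightarrow> 'a set" where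
  "nonnesting_children lt cs C = {u \<in> children cs C. \<not> nesting lt C u}"

lemma ktree_construction_simple_graph:
  "ktree_construction k V E cs \<Longrightarrow> simple_graph V E"
proof (induction rule: ktree_construction.induct)
  case (initial V)
  then show ?case by (simp add: simple_graph_def)
next
  case (add_vertex V E cs C u)
  then show ?case by (auto simp: simple_graph_def nsets_def card_insert_if)
qed

text \<open>Every finite simple graph has a local queue layout, so the minimum in
  \<open>local_queue_number\<close> is attained.\<close>

lemma ex_local_queue_layout:
  assumes "simple_graph V E"
  shows "\<exists>(l::nat) lt P. local_queue_layout (int l) V E lt P"
proof -
  have fin: "finite V" "finite E"
    using assms finite_imp_finite_nsets finite_subset by (auto simp: simple_graph_def)
  obtain r where "well_order_on V r"
    using well_order_on by blast
  then have lin: "strict_linear_order_on V (r - Id)"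
    using strict_linear_order_on_diff_Id well_order_on_def by blast
  define lt where "lt = r - Id"
  define P where "P = (\<lambda>e. {e}) ` E"
  have order: "trans lt" "irrefl lt"
    using lin by (auto simp: lt_def strict_linear_order_on_def)
  have "\<not> nest lt e e" for e
    unfolding nest_def doubleton_eq_iff
    using order by (auto simp: doubleton_eq_iff dest: transD irreflD)
  then have "queue_layout V E lt P"
    using lin
    by (auto simp: queue_layout_def queue_def P_def lt_def partition_on_def disjoint_def)
  moreover have "card {Q \<in> P. \<exists>e\<in>Q. v \<in> e} \<le> card P" for v
    using fin by (intro card_mono) (auto simp: P_def)
  ultimately have "local_queue_layout (int (card P)) V E lt P"
    by (simp add: local_queue_layout_def)
  then show ?thesis by blast
qed

end

theory Submission
  imports Defs
begin

text \<open>Since \<open>l \<le> k\<close> it suffices to exclude \<open>k\<close>-local layouts of a \<open>k\<close>-tree obtained from a hypothesis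
  tree by repeatedly giving many new children to every \<open>k\<close>-clique. Colour every edge by its queue.
  If a clique \<open>K\<close> has many children to its right, then some of them see \<open>K\<close> with the same colour
  vector. This vector is injective, because equal colours would nest, so such a child \<open>u\<close> sees exactly
  the \<open>k\<close> colours of its edges to \<open>K\<close>, and all vertices added later as neighbours of \<open>u\<close> lie to its
  right. Hence one can continue with the cliques \<open>K - f + u\<close>.

  Fix \<open>k - 2\<close> vertices \<open>F \<subseteq> K\<close> and only use cliques containing \<open>F\<close>. An edge to the right of
  \<open>e \<in> F\<close> makes its colour unavailable to the edges from \<open>e\<close> to later vertices, so the number of
  colours available to \<open>F\<close> can drop only boundedly often. As long as it does not drop, the
  colours of the other edges are disjoint from those of \<open>F\<close>, which leaves the problem for \<open>k = 2\<close>.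
  There a chain \<open>v\<^sub>0, v\<^sub>1, \<dots>\<close>, in which \<open>v\<^sub>i\<^sub>+\<^sub>1\<close> is a child of \<open>{d, v\<^sub>i}\<close>, leads to a contradiction.\<close>

section \<open>Towers of children to the right\<close>

text \<open>Order, adjacency and colours all refer to the last level \<open>V R\<close>; the lower
  levels record only when vertices appear. The threshold \<open>2 * k ^ k\<close> yields three
  children with the same colour vector.\<close>

locale edge_coloured_tower =
  fixes less :: "'a \<Rightarrow> 'a \<Rightarrow> bool" (infix "\<sqsubset>" 50)
    and adj :: "'a \<Rightarrow> 'a \<Rightarrow> bool"
    and col :: "'a \<Rightarrow> 'a \<Rightarrow> 'c"
    and V :: "nat \<Rightarrow> 'a set"
    and k R :: nat
  assumes less_trans: "x \<sqsubset> y \<Longrightarrow> y \<sqsubset> z \<Longrightarrow> x \<sqsubset> z"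
    and less_irrefl: "\<not> x \<sqsubset> x"
    and less_total: "x \<in> V R \<Longrightarrow> y \<in> V R \<Longrightarrow> x \<noteq> y \<Longrightarrow> x \<sqsubset> y \<or> y \<sqsubset> x"
    and adj_sym: "adj x y \<Longrightarrow> adj y x"
    and adj_in: "adj x y \<Longrightarrow> x \<in> V R"
    and col_sym: "col x y = col y x"
    and no_nest: "adj u v \<Longrightarrow> adj x y \<Longrightarrow> u \<sqsubset> x \<Longrightarrow> x \<sqsubset> y \<Longrightarrow> y \<sqsubset> v \<Longrightarrow> col u v \<noteq> col x y"
    and finite_colours: "finite {col x y |y. adj x y}"
    and card_colours: "card {col x y |y. adj x y} \<le> k"
    and V_mono: "i \<le> j \<Longrightarrow> V i \<subseteq> V j"
    and many_children: "i < R \<Longrightarrow> C \<subseteq> V i \<Longrightarrow> card C = k \<Longrightarrow> pairwise adj C \<Longrightarrow>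
      \<exists>Y \<subseteq> V (Suc i) - V i. card Y > 2 * k ^ k \<and> (\<forall>y\<in>Y. \<forall>c\<in>C. adj c y)"
    and k_pos: "k > 0"
begin

definition colours :: "'a \<Rightarrow> 'c set" where
  "colours x = {col x y |y. adj x y}"

text \<open>The siblings \<open>u\<^sub>1\<close> and \<open>u\<^sub>2\<close> provide edges around \<open>u\<close> that later edges at \<open>u\<close> must not nest
  with.\<close>

definition node :: "nat \<Rightarrow> 'a set \<Rightarrow> 'a \<Rightarrow> bool" where
  "node j K u \<longleftrightarrow> j \<le> R \<and> K \<subseteq> V j \<and> card K = k \<and> pairwise adj K \<and>
     (\<exists>u\<^sub>1\<in>V j. \<exists>u\<^sub>2\<in>V j. u \<in> V j \<and> u\<^sub>1 \<sqsubset> u \<and> u \<sqsubset> u\<^sub>2 \<and>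
       (\<forall>c\<in>K. c \<sqsubset> u\<^sub>1 \<and> adj c u\<^sub>1 \<and> adj c u \<and> adj c u\<^sub>2 \<and>
          col c u\<^sub>1 = col c u \<and> col c u\<^sub>2 = col c u))"

lemma card_le_mult_fibres:
  assumes "finite U" and "\<And>v. card {u \<in> U. f u = v} \<le> m"
  shows "card U \<le> m * card (f ` U)"
proof -
  have "card U = card (\<Union>v\<in>f ` U. {u \<in> U. f u = v})"
    by (rule arg_cong[where f=card]) auto
  also have "\<dots> \<le> (\<Sum>v\<in>f ` U. card {u \<in> U. f u = v})"
    using assms(1) by (intro card_UN_le) auto
  also have "\<dots> \<le> (\<Sum>v\<in>f ` U. m)"
    by (intro sum_mono assms(2))
  finally show ?thesis by (simp add: mult.commute)
qed

lemma middle_of_three: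
  assumes "card T \<ge> 3" "T \<subseteq> V R"
  obtains a b c where "a \<in> T" "b \<in> T" "c \<in> T" "a \<sqsubset> b" "b \<sqsubset> c"
proof -
  obtain T' where "T' \<subseteq> T" "card T' = 3"
    using assms(1) obtain_subset_with_card_n by metis
  then obtain x y z where "{x, y, z} \<subseteq> T" "x \<noteq> y" "x \<noteq> z" "y \<noteq> z"
    by (auto simp: card_3_iff)
  then have T: "x \<in> T" "y \<in> T" "z \<in> T" by auto
  have "x \<sqsubset> y \<or> y \<sqsubset> x" "x \<sqsubset> z \<or> z \<sqsubset> x" "y \<sqsubset> z \<or> z \<sqsubset> y"
    using T assms(2) \<open>x \<noteq> y\<close> \<open>x \<noteq> z\<close> \<open>y \<noteq> z\<close> less_total by auto
  then show ?thesis using T that by metis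
qed

text \<open>The colours seen from \<open>K\<close> form at most \<open>k ^ k\<close> vectors, so
  three vertices of \<open>Y\<close> share one; the middle one is the node and the outer two are its
  siblings.\<close>

lemma ex_node:
  assumes j: "j \<le> R" and K: "K \<subseteq> V j" "card K = k" "pairwise adj K"
    and Y: "Y \<subseteq> V j" "card Y > 2 * k ^ k" "\<And>y c. y \<in> Y \<Longrightarrow> c \<in> K \<Longrightarrow> c \<sqsubset> y \<and> adj c y"
  shows "\<exists>w\<in>Y. node j K w"
proof -
  define f where "f = (\<lambda>y. \<lambda>c\<in>K. col c y)"
  have finK: "finite K" using K(2) k_pos card_ge_0_finite by metis
  have finY: "finite Y" using Y(2) by (intro card_ge_0_finite) linarith
  have "f ` Y \<subseteq> PiE K colours"
    unfolding f_def by (intro image_subsetI restrict_PiE_iff[THEN iffD2]) (use Y(3) in \<open>auto simp: colours_def\<close>)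
  moreover have "finite (PiE K colours)"
    using finK finite_colours by (intro finite_PiE) (auto simp: colours_def)
  ultimately have "card (f ` Y) \<le> card (PiE K colours)"
    by (intro card_mono)
  also have "\<dots> = (\<Prod>c\<in>K. card (colours c))"
    using finK by (rule card_PiE)
  also have "\<dots> \<le> (\<Prod>c\<in>K. k)"
    using card_colours by (intro prod_mono) (auto simp: colours_def)
  finally have "card (f ` Y) \<le> k ^ k" using K(2) by simp
  then have "\<not> card Y \<le> 2 * card (f ` Y)" using Y(2) by linarith
  then obtain v where v: "\<not> card {y \<in> Y. f y = v} \<le> 2"
    using card_le_mult_fibres[OF finY, of f 2] by blast
  have sub: "{y \<in> Y. f y = v} \<subseteq> V R" using Y(1) V_mono[OF j] by auto
  have "card {y \<in> Y. f y = v} \<ge> 3" using v by simp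
  then obtain a b c where "a \<in> {y \<in> Y. f y = v}" "b \<in> {y \<in> Y. f y = v}" "c \<in> {y \<in> Y. f y = v}"
      "a \<sqsubset> b" "b \<sqsubset> c"
    by (rule middle_of_three[OF _ sub])
  then have abc: "a \<in> Y" "b \<in> Y" "c \<in> Y" "f a = v" "f b = v" "f c = v" "a \<sqsubset> b" "b \<sqsubset> c"
    by auto
  have "col d a = v d" "col d b = v d" "col d c = v d" if "d \<in> K" for d
    using abc(4-6)[THEN fun_cong, of d] that by (simp_all add: f_def)
  then have "\<forall>d\<in>K. d \<sqsubset> a \<and> adj d a \<and> adj d b \<and> adj d c \<and> col d a = col d b \<and> col d c = col d b"
    using Y(3) abc(1-3) by simp
  moreover have "a \<in> V j" "b \<in> V j" "c \<in> V j" using Y(1) abc(1-3) by auto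
  ultimately have "node j K b"
    unfolding node_def using j K abc(7,8) by auto
  with abc(2) show ?thesis by blast
qed

lemma node_mono: "node j K u \<Longrightarrow> j \<le> m \<Longrightarrow> m \<le> R \<Longrightarrow> node m K u"
  unfolding node_def using V_mono[of j m] by blast

lemma nodeD:
  assumes "node j K u"
  shows "j \<le> R" "K \<subseteq> V j" "u \<in> V j" "card K = k" "finite K" "pairwise adj K"
    and "c \<in> K \<Longrightarrow> c \<sqsubset> u" "c \<in> K \<Longrightarrow> adj c u" "u \<notin> K"
  using assms k_pos card_ge_0_finite less_trans less_irrefl unfolding node_def by blast+

text \<open>If \<open>a\<close> precedes \<open>b\<close> in \<open>K\<close>, the edge
  \<open>a u\<close> encloses the edge from \<open>b\<close> to the left sibling of
  \<open>u\<close>, which has the colour of \<open>b u\<close>.\<close>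

lemma node_col_inj:
  assumes "node j K u"
  shows "inj_on (\<lambda>c. col c u) K"
proof -
  have le: "col a u \<noteq> col b u" if "a \<in> K" "b \<in> K" "a \<sqsubset> b" for a b
    using assms that no_nest unfolding node_def by metis
  show ?thesis
  proof (rule inj_onI, rule ccontr)
    fix a b assume ab: "a \<in> K" "b \<in> K" "col a u = col b u" "a \<noteq> b"
    have "a \<in> V R" "b \<in> V R"
      using ab nodeD(1,2)[OF assms] V_mono by blast+
    then show False using le ab less_total by metis
  qed
qed

text \<open>By injectivity the parents already account for \<open>k\<close> colours, the most that
  \<open>u\<close> can see.\<close>

lemma node_colours:
  assumes "node j K u"
  shows "colours u = (\<lambda>c. col c u) ` K"
proof (rule sym, rule card_seteq)
  show "finite (colours u)" using finite_colours by (simp add: colours_def)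
  show "(\<lambda>c. col c u) ` K \<subseteq> colours u"
    using nodeD(8)[OF assms] adj_sym col_sym by (fastforce simp: colours_def)
  show "card (colours u) \<le> card ((\<lambda>c. col c u) ` K)"
    using card_image[OF node_col_inj[OF assms]] nodeD(4)[OF assms] card_colours
    by (simp add: colours_def)
qed

text \<open>An edge from \<open>u\<close> to the left would repeat the colour of some \<open>c u\<close> with \<open>c \<in> K\<close>, and
  would then nest with an edge from \<open>c\<close> to a sibling of \<open>u\<close>.\<close>

lemma node_new_neighbour_right:
  assumes nd: "node j K u" and y: "adj u y" "y \<notin> V j"
  shows "u \<sqsubset> y"
proof (rule ccontr)
  assume "\<not> u \<sqsubset> y"
  have X: "V j \<subseteq> V R" using nodeD(1)[OF nd] V_mono by blast
  have "y \<in> V R" using y adj_sym adj_in by blast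
  with \<open>\<not> u \<sqsubset> y\<close> have yu: "y \<sqsubset> u"
    using less_total y(2) nodeD(3)[OF nd] X by blast
  have "col u y \<in> colours u" using y by (auto simp: colours_def)
  then obtain c where c: "c \<in> K" "col u y = col c u"
    using node_colours[OF nd] by auto
  obtain u1 u2 where s: "u1 \<sqsubset> u" "u \<sqsubset> u2" "c \<sqsubset> u1" "adj c u1" "adj c u2"
      "col c u1 = col c u" "col c u2 = col c u"
    using nd c(1) unfolding node_def by blast
  have "c \<in> V j" "c \<noteq> y" using c(1) nodeD(2)[OF nd] y(2) by auto
  then consider "y \<sqsubset> c" | "c \<sqsubset> y" using less_total X \<open>y \<in> V R\<close> by blast
  then show False
  proof cases
    case 1
    then show False using no_nest[of y u c u1] s c y adj_sym col_sym by metis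
  next
    case 2
    then show False using no_nest[of c u2 y u] s c y adj_sym col_sym yu by metis
  qed
qed

text \<open>All new neighbours of \<open>u\<close> lie to the right of \<open>u\<close>, hence of
  \<open>K\<close>, so \<open>ex_node\<close> applies to the children of the exchanged
  clique.\<close>

lemma node_child:
  assumes nd: "node j K u" and f: "f \<in> K" and j: "j < R"
  shows "\<exists>w. node (Suc j) (insert u (K - {f})) w \<and> w \<notin> V j \<and> u \<sqsubset> w"
proof -
  note D = nodeD[OF nd]
  let ?K = "insert u (K - {f})"
  have sub: "?K \<subseteq> V j" using D(2,3) by auto
  have card: "card ?K = k" using D(4,5,9) f k_pos by (simp add: card_Diff_singleton)
  have pw: "pairwise adj ?K"
    using D(6,8) adj_sym by (auto simp: pairwise_def)
  obtain Y where Y: "Y \<subseteq> V (Suc j) - V j" "card Y > 2 * k ^ k" "\<And>y c. y \<in> Y \<Longrightarrow> c \<in> ?K \<Longrightarrow> adj c y"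
    using many_children[OF j sub card pw] by blast
  have uY: "u \<sqsubset> y" if "y \<in> Y" for y
    using node_new_neighbour_right[OF nd, of y] Y that by blast
  have "\<exists>w\<in>Y. node (Suc j) ?K w"
  proof (rule ex_node)
    show "?K \<subseteq> V (Suc j)" using sub V_mono[of j "Suc j"] by auto
    show "c \<sqsubset> y \<and> adj c y" if "y \<in> Y" "c \<in> ?K" for y c
      using that uY D(7) less_trans Y(3) by blast
  qed (use Y j card pw in auto)
  then show ?thesis using uY Y(1) by blast
qed

text \<open>A colour in \<open>colours e - avail e t\<close> cannot occur on an edge from \<open>e\<close> to a vertex at or
  after \<open>t\<close>.\<close>

definition avail :: "'a \<Rightarrow> 'a \<Rightarrow> 'c set" where
  "avail e t = colours e - {col x y |x y. adj x y \<and> e \<sqsubset> x \<and> x \<sqsubset> y \<and> y \<sqsubset> t}"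

text \<open>This never increases as \<open>t\<close> moves right and is at most
  \<open>k * card F\<close>, so it can serve as the measure of a descent.\<close>

definition potential :: "'a set \<Rightarrow> 'a \<Rightarrow> nat" where
  "potential F t = (\<Sum>e\<in>F. card (avail e t))"

lemma finite_avail: "finite (avail e t)"
  using finite_colours by (simp add: avail_def colours_def)

lemma avail_antimono: "s \<sqsubset> t \<Longrightarrow> avail e t \<subseteq> avail e s"
  unfolding avail_def using less_trans[of _ s t] by blast

lemma node_col_avail:
  assumes "node j K w" "e \<in> K"
  shows "col e w \<in> avail e w"
proof -
  have ew: "adj e w" using nodeD(8)[OF assms] .
  have "col e w \<noteq> col x y" if "adj x y" "e \<sqsubset> x" "x \<sqsubset> y" "y \<sqsubset> w" for x y
    using no_nest[OF ew that] .
  then show ?thesis using ew by (auto simp: avail_def colours_def)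
qed

lemma avail_eq_of_potential_le:
  assumes "finite F" "u \<sqsubset> w" "potential F u \<le> potential F w" "e \<in> F"
  shows "avail e w = avail e u"
proof (rule ccontr)
  assume "avail e w \<noteq> avail e u"
  then have "card (avail e w) < card (avail e u)"
    using avail_antimono[OF assms(2)] finite_avail by (intro psubset_card_mono) auto
  then have "potential F w < potential F u"
    unfolding potential_def using assms avail_antimono[OF assms(2)] finite_avail
    by (intro sum_strict_mono_ex1) (auto intro!: card_mono)
  with assms(3) show False by simp
qed

section \<open>The reduction to two parents\<close>

definition avails :: "'a set \<Rightarrow> 'a \<Rightarrow> 'c set" where
  "avails F u = (\<Union>e\<in>F. avail e u)"

text \<open>The vertex \<open>u\<close> marks the time from which on \<open>F\<close> loses no available colours. By
  \<open>duo_col\<close> below, the edges of a duo not meeting \<open>F\<close> then behave like those of a \<open>2\<close>-tree.\<close>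

definition duo :: "'a set \<Rightarrow> 'a \<Rightarrow> nat \<Rightarrow> 'a \<Rightarrow> 'a \<Rightarrow> 'a \<Rightarrow> bool" where
  "duo F u j a b w \<longleftrightarrow> node j (insert a (insert b F)) w \<and> a \<noteq> b \<and> a \<notin> F \<and> b \<notin> F \<and> u \<sqsubset> w \<and>
     (\<forall>e\<in>F. e \<sqsubset> a \<and> e \<sqsubset> b \<and> col e w \<in> avails F u) \<and>
     col a w \<notin> avails F u \<and> col b w \<notin> avails F u"

lemma duo_sym: "duo F u j a b w \<Longrightarrow> duo F u j b a w"
  by (auto simp: duo_def insert_commute)

lemma duoD:
  assumes "duo F u j a b w"
  shows "a \<sqsubset> w" "b \<sqsubset> w" "adj a w" "adj b w" "a \<in> V j" "b \<in> V j" "w \<in> V j"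
    and "col a w \<noteq> col b w" "j \<le> R"
proof -
  have nd: "node j (insert a (insert b F)) w" and ab: "a \<noteq> b"
    using assms by (auto simp: duo_def)
  show "a \<sqsubset> w" "b \<sqsubset> w" "adj a w" "adj b w" "a \<in> V j" "b \<in> V j" "w \<in> V j" "j \<le> R"
    using nodeD[OF nd] by auto
  show "col a w \<noteq> col b w"
    using node_col_inj[OF nd] ab by (auto simp: inj_on_def)
qed

text \<open>All colours at \<open>w\<close> come from its parents. Those from \<open>F\<close> lie
  in \<open>avails F u\<close>, which the colour of \<open>w x\<close> avoids.\<close>

lemma duo_col:
  assumes "duo F u j a b w" "duo F u j' w g x"
  shows "col w x = col a w \<or> col w x = col b w"
proof -
  have "col w x \<in> colours w"
    using duoD(3)[OF assms(2)] by (auto simp: colours_def)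
  moreover have "colours w = (\<lambda>c. col c w) ` insert a (insert b F)"
    using assms(1) node_colours by (auto simp: duo_def)
  ultimately show ?thesis
    using assms by (auto simp: duo_def)
qed

text \<open>The free level \<open>m\<close> lets a child be taken after any vertices already
  constructed; \<open>x \<notin> V m\<close> then makes it distinct from them.\<close>

definition growing :: "'a set \<Rightarrow> 'a \<Rightarrow> nat \<Rightarrow> bool" where
  "growing F u J \<longleftrightarrow> (\<forall>j m a b w. duo F u j a b w \<longrightarrow> j \<le> m \<longrightarrow> m < J \<longrightarrow>
     (\<exists>x. duo F u (Suc m) b w x \<and> x \<notin> V m))"

lemma growingD:
  "growing F u J \<Longrightarrow> duo F u j a b w \<Longrightarrow> j \<le> m \<Longrightarrow> m < J \<Longrightarrow>
     \<exists>x. duo F u (Suc m) b w x \<and> x \<notin> V m"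
  by (auto simp: growing_def)

lemma duo_chain:
  assumes "growing F u J" "duo F u j g d v\<^sub>0" "j \<le> m" "m + n \<le> J"
  shows "\<exists>v. v 0 = v\<^sub>0 \<and> (\<forall>i<n. duo F u (m + Suc i) d (v i) (v (Suc i)))"
  using assms(4)
proof (induction n)
  case 0
  then show ?case by auto
next
  case (Suc n)
  then obtain v where v: "v 0 = v\<^sub>0" "\<And>i. i < n \<Longrightarrow> duo F u (m + Suc i) d (v i) (v (Suc i))"
    by auto
  \<comment> \<open>\<open>growing\<close> discards the first parent, so the duo of
    \<open>v n\<close> is oriented with \<open>d\<close> second.\<close>
  have "\<exists>j' g'. j' \<le> m + n \<and> duo F u j' g' d (v n)"
  proof (cases n)
    case 0
    then show ?thesis using assms(2,3) v by auto
  next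
    case (Suc n')
    then have "duo F u (m + n) (v n') d (v n)" using duo_sym[OF v(2)[of n']] by simp
    then show ?thesis by blast
  qed
  then obtain x where x: "duo F u (Suc (m + n)) d (v n) x"
    using growingD[OF assms(1)] Suc.prems by (metis add_Suc_right less_eq_Suc_le)
  have "\<forall>i<Suc n. duo F u (m + Suc i) d ((v(Suc n := x)) i) ((v(Suc n := x)) (Suc i))"
    using v x by (auto simp: less_Suc_eq)
  then show ?case using v(1) by (intro exI[of _ "v(Suc n := x)"]) simp
qed

text \<open>All edges \<open>v\<^sub>i v\<^sub>i\<^sub>+\<^sub>1\<close> get a common colour \<open>z \<noteq> r\<close>. The edges from a child \<open>y\<close> of \<open>{v\<^sub>1, v\<^sub>2}\<close> to its
  parents have the colours \<open>r\<close> and \<open>z\<close>: the former forces \<open>y\<close> beyond \<open>v\<^sub>4\<close>, and then the latter nests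
  over an edge of the chain.\<close>

lemma constant_chain_False:
  assumes gr: "growing F u J" and J: "m + 4 < J"
    and v: "\<And>i. i < 4 \<Longrightarrow> duo F u (m + Suc i) d (v i) (v (Suc i))"
    and r: "\<And>i. 1 \<le> i \<Longrightarrow> i \<le> 4 \<Longrightarrow> col d (v i) = r"
  shows False
proof -
  have n: "duo F u (m + 1) d (v 0) (v 1)" "duo F u (m + 2) d (v 1) (v 2)"
    "duo F u (m + 3) d (v 2) (v 3)" "duo F u (m + 4) d (v 3) (v 4)"
    using v[of 0] v[of 1] v[of 2] v[of 3] by (simp_all add: eval_nat_numeral)
  have r': "col d (v 1) = r" "col d (v 2) = r" "col d (v 3) = r" "col d (v 4) = r"
    using r by auto
  define z where "z = col (v 0) (v 1)"
  have z0: "z \<noteq> r" using duoD(8)[OF n(1)] r' by (simp add: z_def)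
  have z1: "col (v 1) (v 2) = z"
    using duo_col[OF n(1) duo_sym[OF n(2)]] duoD(8)[OF n(2)] r' by (auto simp: z_def)
  have z2: "col (v 2) (v 3) = z"
    using duo_col[OF n(2) duo_sym[OF n(3)]] duoD(8)[OF n(3)] r' z1 by auto
  have z3: "col (v 3) (v 4) = z"
    using duo_col[OF n(3) duo_sym[OF n(4)]] duoD(8)[OF n(4)] r' z2 by auto
  \<comment> \<open>Level \<open>m + 4\<close> contains \<open>v 4\<close>, so \<open>y\<close>
    differs from it.\<close>
  obtain y where y: "duo F u (Suc (m + 4)) (v 1) (v 2) y" "y \<notin> V (m + 4)"
    using growingD[OF gr n(2), of "m + 4"] J by auto
  have y1: "col (v 1) y = r \<or> col (v 1) y = z"
    using duo_col[OF n(1) y(1)] r' by (auto simp: z_def)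
  have y2: "col (v 2) y = r \<or> col (v 2) y = z"
    using duo_col[OF n(2) duo_sym[OF y(1)]] r' z1 by auto
  note y12 = duoD(8)[OF y(1)]
  have ord: "d \<sqsubset> v 1" "d \<sqsubset> v 2" "v 1 \<sqsubset> v 2" "v 2 \<sqsubset> v 3" "v 3 \<sqsubset> v 4" "v 1 \<sqsubset> y" "v 2 \<sqsubset> y"
    using n y duoD(1,2) by blast+
  have ad: "adj d (v 4)" "adj (v 2) (v 3)" "adj (v 3) (v 4)" "adj (v 1) y" "adj (v 2) y"
    using n y duoD(3,4) by blast+
  have "y \<in> V R" "v 4 \<in> V R" "y \<noteq> v 4"
    using duoD(7)[OF n(4)] y(2) duoD(7)[OF y(1)] V_mono duoD(9)[OF n(4)] duoD(9)[OF y(1)] by blast+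
  then consider "y \<sqsubset> v 4" | "v 4 \<sqsubset> y" using less_total by blast
  then show False
  proof cases
    case 1
    \<comment> \<open>The edge from \<open>d\<close> to \<open>v 4\<close> encloses both edges, so
      both have colour \<open>z\<close>, but their colours must differ.\<close>
    have "col (v 1) y \<noteq> r" "col (v 2) y \<noteq> r"
      using no_nest[of d "v 4" "v 1" y] no_nest[of d "v 4" "v 2" y] ord ad 1 r' by auto
    then show False using y1 y2 y12 by auto
  next
    case 2
    have "v 3 \<sqsubset> y" using 2 ord less_trans by blast
    have "col (v 1) y \<noteq> z" "col (v 2) y \<noteq> z"
      using no_nest[of "v 1" y "v 2" "v 3"] no_nest[of "v 2" y "v 3" "v 4"] ord ad 2
        \<open>v 3 \<sqsubset> y\<close> z2 z3 by auto
    then show False using y1 y2 y12 by auto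
  qed
qed

lemma chain_less:
  assumes "\<And>i. i < n \<Longrightarrow> v i \<sqsubset> v (Suc i)" "i < j" "j \<le> n"
  shows "v i \<sqsubset> v j"
  using assms(2,3)
proof (induction j)
  case (Suc j)
  then show ?case using assms(1)[of j] less_trans[of "v i" "v j"] by (cases "i = j") auto
qed simp

text \<open>By the previous lemma both colours available to \<open>d\<close> recur at the end of a chain with fixed
  parent \<open>d\<close>, so the edges of the chain share a third colour \<open>z\<close>. A child \<open>y\<close> of \<open>{v\<^sub>1, v\<^sub>2}\<close> then lies
  beyond \<open>v\<^sub>4\<close>, and the edges from \<open>v\<^sub>1\<close> to a second chain starting at \<open>y\<close> cannot have colour \<open>z\<close>, so
  they have constant colour.\<close>

lemma growing_duo_False:
  assumes gr: "growing F u J" and d: "duo F u j g h d" and J: "j + 15 \<le> J"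
  shows False
proof -
  \<comment> \<open>The first chain ends at level \<open>j + 9\<close>, the child \<open>y\<close>
    has level \<open>j + 10\<close>, the second chain ends at level \<open>j + 14\<close>, and
    \<open>constant_chain_False\<close> asks for one level more; hence
    \<open>j + 15\<close>.\<close>
  obtain v\<^sub>0 where v0: "duo F u (Suc j) h d v\<^sub>0"
    using growingD[OF gr d, of j] J by auto
  obtain v where v00: "v 0 = v\<^sub>0"
    and v: "\<And>i. i < 8 \<Longrightarrow> duo F u (Suc j + Suc i) d (v i) (v (Suc i))"
    using duo_chain[OF gr v0, of "Suc j" 8] J by auto
  have vless: "v i \<sqsubset> v i'" if "i < i'" "i' \<le> 8" for i i'
    using chain_less[of 8 v, OF _ that] v duoD(2) by blast
  have dv: "d \<sqsubset> v i" "adj d (v i)" "v i \<in> V (j + 9)" if "i \<le> 8" for i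
  proof -
    have "\<exists>j' b. duo F u j' d b (v i) \<and> j' \<le> j + 9"
    proof (cases i)
      case 0
      then show ?thesis using duo_sym[OF v0] v00 by (intro exI[of _ "Suc j"]) auto
    next
      case (Suc i')
      then show ?thesis
        using v[of i'] that by (intro exI[of _ "Suc j + Suc i'"]) auto
    qed
    then obtain j' b where b: "duo F u j' d b (v i)" "j' \<le> j + 9" by blast
    show "d \<sqsubset> v i" "adj d (v i)" "v i \<in> V (j + 9)"
      using duoD(1,3,7)[OF b(1)] V_mono[OF b(2)] by auto
  qed
  have rS: "col d (v i) = col g d \<or> col d (v i) = col h d" if "i \<le> 8" for i
  proof (cases i)
    case 0
    then show ?thesis using duo_col[OF d duo_sym[OF v0]] v00 by simp
  next
    case (Suc i')
    then show ?thesis using duo_col[OF d v[of i']] that by simp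
  qed
  \<comment> \<open>The vertices \<open>v 5\<close> to \<open>v 8\<close> are the positions 1 to 4
    of the chain starting at \<open>v 4\<close>, which cannot have constant colour.\<close>
  have nconst: "\<exists>i\<in>{5..8}. col d (v i) \<noteq> r" for r
  proof (rule ccontr)
    assume "\<not> ?thesis"
    then have "\<And>i. 1 \<le> i \<Longrightarrow> i \<le> 4 \<Longrightarrow> col d (v (i + 4)) = r" by auto
    moreover have "duo F u (j + 5 + Suc i) d (v (i + 4)) (v (Suc i + 4))" if "i < 4" for i
      using v[of "i + 4"] that by (simp add: algebra_simps)
    ultimately show False
      using constant_chain_False[OF gr, of "j + 5" d "\<lambda>i. v (i + 4)" r] J by auto
  qed
  \<comment> \<open>Only two colours are possible, so if one were missing the other would be
    constant.\<close>
  have recur: "\<exists>i'\<in>{5..8}. col d (v i') = c" if "c = col g d \<or> c = col h d" for c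
    using that nconst[of "col g d"] nconst[of "col h d"] rS by force
  \<comment> \<open>These chain edges end at \<open>v 4\<close> or earlier, so they are enclosed by
    the edges from \<open>d\<close> to \<open>v 5\<close>, ..., \<open>v 8\<close>, on which both
    colours occur.\<close>
  have zS: "col (v i) (v (Suc i)) \<noteq> col g d \<and> col (v i) (v (Suc i)) \<noteq> col h d" if "i \<le> 3" for i
  proof -
    have "adj (v i) (v (Suc i))" using v[of i] that duoD(4) by simp
    then have "col (v i) (v (Suc i)) \<noteq> col d (v i')" if "i' \<in> {5..8}" for i'
      using no_nest[of d "v i'" "v i" "v (Suc i)"] dv[of i] dv[of i'] vless[of i "Suc i"]
        vless[of "Suc i" i'] that \<open>i \<le> 3\<close> by auto
    then show ?thesis using recur by metis
  qed
  have n: "duo F u (j + 2) d (v 0) (v 1)" "duo F u (j + 3) d (v 1) (v 2)"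
    "duo F u (j + 4) d (v 2) (v 3)"
    using v[of 0] v[of 1] v[of 2] by (simp_all add: eval_nat_numeral)
  define z where "z = col (v 0) (v 1)"
  have z1: "col (v 1) (v 2) = z"
    using duo_col[OF n(1) duo_sym[OF n(2)]] zS[of 1] rS[of 1] by (auto simp: z_def eval_nat_numeral)
  have z2: "col (v 2) (v 3) = z"
    using duo_col[OF n(2) duo_sym[OF n(3)]] zS[of 2] rS[of 2] z1 by (auto simp: eval_nat_numeral)
  obtain y where y: "duo F u (Suc (j + 9)) (v 1) (v 2) y" "y \<notin> V (j + 9)"
    using growingD[OF gr n(2), of "j + 9"] J by auto
  have y1: "col (v 1) y = col d (v 1) \<or> col (v 1) y = z"
    using duo_col[OF n(1) y(1)] by (auto simp: z_def)
  have y2: "col (v 2) y = col d (v 2) \<or> col (v 2) y = z"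
    using duo_col[OF n(2) duo_sym[OF y(1)]] z1 by auto
  have "v 4 \<in> V R" "y \<in> V R" "y \<noteq> v 4"
    using dv(3)[of 4] y(2) duoD(7)[OF y(1)] V_mono[OF duoD(9)[OF y(1)]] V_mono[of "j + 9" R]
      duoD(9)[OF y(1)] by auto
  \<comment> \<open>Otherwise an edge from \<open>d\<close> to one of \<open>v 5\<close>, ...,
    \<open>v 8\<close> with the colour of \<open>d\<close>, \<open>v a\<close> encloses the edge
    from \<open>v a\<close> to \<open>y\<close>; then both edges at \<open>y\<close> would have
    colour \<open>z\<close>.\<close>
  moreover have "\<not> y \<sqsubset> v 4"
  proof
    assume "y \<sqsubset> v 4"
    have "col (v a) y \<noteq> col d (v a)" if "a = 1 \<or> a = 2" for a
    proof -
      obtain p where p: "p \<in> {5..8}" "col d (v p) = col d (v a)"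
        using recur[of "col d (v a)"] rS[of a] \<open>a = 1 \<or> a = 2\<close> by auto
      have "y \<sqsubset> v p" using \<open>y \<sqsubset> v 4\<close> vless[of 4 p] p less_trans[of y "v 4" "v p"] by auto
      moreover have "v a \<sqsubset> y" "adj (v a) y" using duoD(1-4)[OF y(1)] that by blast+
      ultimately show ?thesis
        using no_nest[of d "v p" "v a" y] dv[of p] dv[of a] p that by auto
    qed
    then show False using y1 y2 duoD(8)[OF y(1)] by auto
  qed
  ultimately have "v 4 \<sqsubset> y" using less_total by blast
  then have y3: "v 3 \<sqsubset> y" using vless[of 3 4] less_trans[of "v 3" "v 4" y] by auto
  \<comment> \<open>The second chain keeps \<open>v 1\<close> as parent and starts at
    \<open>y\<close>, beyond \<open>v 3\<close>, so that its edges from \<open>v 1\<close> enclose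
    the edge from \<open>v 2\<close> to \<open>v 3\<close> of colour \<open>z\<close>.\<close>
  obtain v' where v'0: "v' 0 = y"
    and v': "\<And>i. i < 4 \<Longrightarrow> duo F u (j + 10 + Suc i) (v 1) (v' i) (v' (Suc i))"
    using duo_chain[OF gr duo_sym[OF y(1)], of "j + 10" 4] J by auto
  have "col (v 1) (v' i) = col d (v 1)" if i: "1 \<le> i" "i \<le> 4" for i
  proof -
    have di: "duo F u (j + 10 + i) (v 1) (v' (i - 1)) (v' i)"
      using v'[of "i - 1"] i by simp
    have "y \<sqsubset> v' i"
      using chain_less[of 4 v' 0 i, OF duoD(2)[OF v']] v'0 i by simp
    then have "v 3 \<sqsubset> v' i" using y3 less_trans by blast
    then have "col (v 1) (v' i) \<noteq> z"
      using no_nest[of "v 1" "v' i" "v 2" "v 3"] vless[of 1 2] vless[of 2 3] z2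
        duoD(3)[OF di] duoD(4)[OF n(3)] by auto
    then show ?thesis using duo_col[OF n(1) di] by (auto simp: z_def)
  qed
  then show False
    using constant_chain_False[OF gr _ v', of "col d (v 1)"] J by auto
qed

section \<open>Descent of the potential\<close>

text \<open>A steady potential keeps each \<open>avail e\<close> unchanged from \<open>u\<close> to
  \<open>w\<close>. The colour of \<open>e w\<close> is available at \<open>w\<close>, while
  \<open>g w\<close> repeats the colour of an edge that lies after \<open>e\<close> and ends before
  \<open>w\<close>.\<close>

lemma steady_node:
  assumes nd: "node j K w" and F: "F \<subseteq> K" "u \<sqsubset> w" "potential F u \<le> potential F w"
  shows "e \<in> F \<Longrightarrow> col e w \<in> avails F u"
    and "g \<in> K \<Longrightarrow> \<forall>e\<in>F. e \<sqsubset> g \<Longrightarrow> col g w \<notin> avails F u"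
proof -
  have eq: "avail e w = avail e u" if "e \<in> F" for e
    using avail_eq_of_potential_le[OF _ F(2,3) that] F(1) nodeD(5)[OF nd] finite_subset by blast
  show "col e w \<in> avails F u" if "e \<in> F"
    using node_col_avail[OF nd] eq[OF that] F(1) that by (auto simp: avails_def)
  show "col g w \<notin> avails F u" if g: "g \<in> K" "\<forall>e\<in>F. e \<sqsubset> g"
  proof
    assume "col g w \<in> avails F u"
    then obtain e where e: "e \<in> F" "col g w \<in> avail e w" using eq by (auto simp: avails_def)
    \<comment> \<open>The left sibling is taken because \<open>avail e w\<close> excludes only
      colours of edges ending strictly before \<open>w\<close>.\<close>
    obtain u1 where u1: "u1 \<sqsubset> w" "g \<sqsubset> u1" "adj g u1" "col g u1 = col g w"
      using nd g(1) unfolding node_def by blast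
    moreover have "e \<sqsubset> g" using e g(2) by blast
    ultimately have "col g u1 \<notin> avail e w" unfolding avail_def by blast
    with u1 e show False by simp
  qed
qed

text \<open>If twenty levels bring no decrease, \<open>F\<close> is steady there, so every exchange
  of parents yields another duo and \<open>growing_duo_False\<close> applies. The initial duo uses
  two levels, and fifteen more suffice.\<close>

lemma potential_decreases:
  assumes nd: "node i K u" and F: "F \<subseteq> K" "card F + 2 = k" and R: "i + 20 \<le> R"
  shows "\<exists>j K' w. node j K' w \<and> F \<subseteq> K' \<and> j \<le> i + 20 \<and> potential F w < potential F u"
proof (rule ccontr)
  assume neg: "\<not> ?thesis"
  then have steady: "potential F u \<le> potential F w" if "node j K' w" "F \<subseteq> K'" "j \<le> i + 20" for j K' w
    using that not_less by blast
  have gr: "growing F u (i + 20)"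
    unfolding growing_def
  proof (intro allI impI)
    fix j m a b w assume duo: "duo F u j a b w" and m: "j \<le> m" "m < i + 20"
    have nw: "node m (insert a (insert b F)) w"
      using duo m R node_mono by (auto simp: duo_def)
    note w = nodeD[OF nw]
    obtain x where x: "node (Suc m) (insert w (insert a (insert b F) - {a})) x" "x \<notin> V m" "w \<sqsubset> x"
      using node_child[OF nw, of a] m R by auto
    have ab: "a \<noteq> b" "a \<notin> F" "b \<notin> F" "u \<sqsubset> w" "\<forall>e\<in>F. e \<sqsubset> b"
      using duo by (auto simp: duo_def)
    have "insert w (insert a (insert b F) - {a}) = insert b (insert w F)"
      using ab by auto
    with x have nx: "node (Suc m) (insert b (insert w F)) x" by simp
    have ux: "u \<sqsubset> x" using ab(4) x(3) less_trans by blast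
    have st: "potential F u \<le> potential F x" using steady[OF nx] m by auto
    have Fw: "\<forall>e\<in>F. e \<sqsubset> w" using w(7) by auto
    have "F \<subseteq> insert b (insert w F)" by auto
    note sn = steady_node[OF nx this ux st]
    have "duo F u (Suc m) b w x"
      unfolding duo_def using nx ab ux w(9) Fw sn(1) sn(2)[of b] sn(2)[of w] by auto
    then show "\<exists>x. duo F u (Suc m) b w x \<and> x \<notin> V m" using x by blast
  qed
  note D = nodeD[OF nd]
  \<comment> \<open>Two exchanges replace both vertices outside \<open>F\<close> by \<open>u\<close>
    and \<open>w\<close>, since the two parents in a duo must lie after all of
    \<open>F\<close>.\<close>
  have "card (K - F) = 2"
    using F D(4,5) by (simp add: card_Diff_subset finite_subset)
  then obtain p q where pq: "K - F = {p, q}" "p \<noteq> q" by (auto simp: card_2_iff)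
  obtain w where w: "node (Suc i) (insert u (K - {q})) w" "u \<sqsubset> w"
    using node_child[OF nd, of q] pq R by auto
  obtain x where x: "node (Suc (Suc i)) (insert w (insert u (K - {q}) - {p})) x" "w \<sqsubset> x"
    using node_child[OF w(1), of p] pq R by auto
  have "u \<noteq> p" using D(9) pq by auto
  then have "insert w (insert u (K - {q}) - {p}) = insert u (insert w F)"
    using pq F(1) by auto
  with x have nx: "node (Suc (Suc i)) (insert u (insert w F)) x" by simp
  have ux: "u \<sqsubset> x" using w(2) x(2) less_trans by blast
  have st: "potential F u \<le> potential F x" using steady[OF nx] by auto
  have Fu: "\<forall>e\<in>F. e \<sqsubset> u" using D(7) F(1) by auto
  then have Fw: "\<forall>e\<in>F. e \<sqsubset> w" using w(2) less_trans by blast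
  have "F \<subseteq> insert u (insert w F)" by auto
  note sn = steady_node[OF nx this ux st]
  have "duo F u (Suc (Suc i)) u w x"
    unfolding duo_def using nx ux w(2) Fu Fw less_irrefl sn(1) sn(2)[of u] sn(2)[of w] by auto
  from growing_duo_False[OF gr this] show False by simp
qed

text \<open>Each decrease of the potential costs at most twenty levels.\<close>

lemma node_False:
  assumes "node i K u" "F \<subseteq> K" "card F + 2 = k" "i + 20 * (potential F u + 1) \<le> R"
  shows False
  using assms
proof (induction "potential F u" arbitrary: i K u rule: less_induct)
  case less
  obtain j K' w where w: "node j K' w" "F \<subseteq> K'" "j \<le> i + 20" "potential F w < potential F u"
    using potential_decreases[OF less.prems(1,2,3)] less.prems(4) by auto
  then show False using less.hyps[OF w(4,1,2) less.prems(3)] less.prems(4) by auto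
qed

lemma many_right_children_False:
  assumes k: "k > 1" and R: "20 * (k * k + 1) \<le> R"
    and C: "C \<subseteq> V 0" "card C = k" "pairwise adj C"
    and U: "U \<subseteq> V 0" "card U > 2 * k ^ k" "\<And>u c. u \<in> U \<Longrightarrow> c \<in> C \<Longrightarrow> c \<sqsubset> u \<and> adj c u"
  shows False
proof -
  obtain u where u: "node 0 C u"
    using ex_node[OF _ C U] by auto
  \<comment> \<open>Any such \<open>F\<close> has potential at most \<open>k * k\<close>, which
    explains the height \<open>20 * (k * k + 1)\<close>.\<close>
  obtain F where F: "F \<subseteq> C" "card F = k - 2"
    using obtain_subset_with_card_n[of "k - 2" C] C(2) by auto
  have "potential F u \<le> (\<Sum>e\<in>F. k)"
    unfolding potential_def
  proof (rule sum_mono)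
    fix e
    have "card (avail e u) \<le> card (colours e)"
      using finite_colours by (intro card_mono) (auto simp: avail_def colours_def)
    also have "\<dots> \<le> k" using card_colours by (simp add: colours_def)
    finally show "card (avail e u) \<le> k" .
  qed
  also have "\<dots> \<le> k * k" using F(2) by simp
  finally have "potential F u + 1 \<le> k * k + 1" by simp
  then have "20 * (potential F u + 1) \<le> R" using R by (meson mult_le_mono2 order_trans)
  moreover have "card F + 2 = k" using F(2) k by linarith
  ultimately show False using node_False[OF u F(1)] by simp
qed

end

section \<open>Extending a k-tree and restricting its layouts\<close>

text \<open>Asking for an induced subgraph ensures that a clique of the later graph inside
  \<open>V\<close> was already a clique when \<open>V\<close> was extended.\<close>

definition ktree_extension :: "nat \<Rightarrow> 'a set \<Rightarrow> 'a set set \<Rightarrow> 'a set \<Rightarrow> 'a set set \<Rightarrow> bool" where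
  "ktree_extension k V E V' E' \<longleftrightarrow>
     k_tree k V' E' \<and> V \<subseteq> V' \<and> E \<subseteq> E' \<and> (\<forall>e\<in>E'. e \<subseteq> V \<longrightarrow> e \<in> E)"

lemma ktree_extension_refl: "k_tree k V E \<Longrightarrow> ktree_extension k V E V E"
  by (simp add: ktree_extension_def)

lemma ktree_extension_trans:
  assumes "ktree_extension k V E V' E'" "ktree_extension k V' E' V'' E''"
  shows "ktree_extension k V E V'' E''"
  using assms unfolding ktree_extension_def by (meson order_trans)

lemma k_tree_simple_graph: "k_tree k V E \<Longrightarrow> simple_graph V E"
  using ktree_construction_simple_graph by (auto simp: k_tree_def)

lemma clique_mono: "clique C E \<Longrightarrow> E \<subseteq> E' \<Longrightarrow> clique C E'"
  by (auto simp: clique_def)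

lemma ktree_extension_children:
  fixes V :: "'a set"
  assumes inf: "infinite (UNIV :: 'a set)" and kt: "k_tree k V E"
    and C: "C \<subseteq> V" "card C = k" "clique C E"
  shows "\<exists>V' E'. ktree_extension k V E V' E' \<and>
    (\<exists>Y \<subseteq> V' - V. card Y = n \<and> (\<forall>y\<in>Y. \<forall>c\<in>C. {y, c} \<in> E'))"
proof (induction n)
  case 0
  show ?case using ktree_extension_refl[OF kt] by (intro exI[of _ V] exI[of _ E]) auto
next
  case (Suc n)
  then obtain V' E' Y where *: "ktree_extension k V E V' E'" "Y \<subseteq> V' - V" "card Y = n"
      "\<forall>y\<in>Y. \<forall>c\<in>C. {y, c} \<in> E'"
    by blast
  have fin: "finite V'"
    using *(1) k_tree_simple_graph by (auto simp: ktree_extension_def simple_graph_def)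
  then obtain u where u: "u \<notin> V'" using inf ex_new_if_finite by blast
  obtain cs where cs: "ktree_construction k V' E' cs"
    using *(1) by (auto simp: ktree_extension_def k_tree_def)
  have CV': "C \<subseteq> V'" and "clique C E'"
    using C *(1) clique_mono by (auto simp: ktree_extension_def)
  let ?E = "E' \<union> {{u, c} |c. c \<in> C}"
  have "k_tree k (insert u V') ?E"
    using ktree_construction.add_vertex[OF cs CV' C(2) \<open>clique C E'\<close> u] by (auto simp: k_tree_def)
  then have "ktree_extension k V' E' (insert u V') ?E"
    using u by (auto simp: ktree_extension_def)
  moreover have "card (insert u Y) = Suc n"
    using *(2,3) u fin finite_subset[of Y V'] by (subst card_insert_disjoint) auto
  moreover have "insert u Y \<subseteq> insert u V' - V"
    using *(1,2) u by (auto simp: ktree_extension_def)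
  moreover have "\<forall>y\<in>insert u Y. \<forall>c\<in>C. {y, c} \<in> ?E" using *(4) by auto
  ultimately show ?case using ktree_extension_trans[OF *(1)] by meson
qed

text \<open>The finitely many cliques are served one at a time; later extensions preserve the
  children already added.\<close>

lemma ktree_extension_all_children:
  fixes V :: "'a set"
  assumes inf: "infinite (UNIV :: 'a set)" and kt: "k_tree k V E"
  shows "\<exists>V' E'. ktree_extension k V E V' E' \<and>
    (\<forall>C\<subseteq>V. card C = k \<longrightarrow> clique C E \<longrightarrow>
      (\<exists>Y \<subseteq> V' - V. card Y = n \<and> (\<forall>y\<in>Y. \<forall>c\<in>C. {y, c} \<in> E')))"
proof -
  let ?S = "{C. C \<subseteq> V \<and> card C = k \<and> clique C E}"
  have "finite V" using kt k_tree_simple_graph by (auto simp: simple_graph_def)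
  then have "finite ?S" by simp
  moreover have "\<exists>V' E'. ktree_extension k V E V' E' \<and>
      (\<forall>C\<in>S. \<exists>Y \<subseteq> V' - V. card Y = n \<and> (\<forall>y\<in>Y. \<forall>c\<in>C. {y, c} \<in> E'))"
    if "finite S" "S \<subseteq> ?S" for S
    using that
  proof (induction S)
    case empty
    then show ?case using ktree_extension_refl[OF kt] by blast
  next
    case (insert C S)
    then obtain V' E' where *: "ktree_extension k V E V' E'"
        "\<forall>C\<in>S. \<exists>Y \<subseteq> V' - V. card Y = n \<and> (\<forall>y\<in>Y. \<forall>c\<in>C. {y, c} \<in> E')"
      by auto
    have V': "k_tree k V' E'" "V \<subseteq> V'" "E \<subseteq> E'"
      using *(1) by (auto simp: ktree_extension_def)
    have C: "C \<subseteq> V'" "card C = k" "clique C E'"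
      using insert.prems V'(2) clique_mono[OF _ V'(3)] by auto
    obtain V'' E'' Y where **: "ktree_extension k V' E' V'' E''" "Y \<subseteq> V'' - V'" "card Y = n"
        "\<forall>y\<in>Y. \<forall>c\<in>C. {y, c} \<in> E''"
      using ktree_extension_children[OF inf V'(1) C, of n] by blast
    have sub: "V' \<subseteq> V''" "E' \<subseteq> E''" using **(1) by (auto simp: ktree_extension_def)
    have "\<exists>Y \<subseteq> V'' - V. card Y = n \<and> (\<forall>y\<in>Y. \<forall>c\<in>D. {y, c} \<in> E'')" if D: "D \<in> insert C S" for D
    proof (cases "D = C")
      case True
      moreover have "Y \<subseteq> V'' - V" using **(2) V'(2) by blast
      ultimately show ?thesis using **(3,4) by blast
    next
      case False
      then obtain Z where Z: "Z \<subseteq> V' - V" "card Z = n" "\<forall>y\<in>Z. \<forall>c\<in>D. {y, c} \<in> E'"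
        using D *(2) by blast
      have "Z \<subseteq> V'' - V" "\<forall>y\<in>Z. \<forall>c\<in>D. {y, c} \<in> E''" using Z(1,3) sub by auto
      with Z(2) show ?thesis by blast
    qed
    with ktree_extension_trans[OF *(1) **(1)] show ?case by meson
  qed
  ultimately obtain V' E' where "ktree_extension k V E V' E'"
      "\<forall>C\<in>?S. \<exists>Y \<subseteq> V' - V. card Y = n \<and> (\<forall>y\<in>Y. \<forall>c\<in>C. {y, c} \<in> E')"
    by blast
  then show ?thesis by blast
qed

section \<open>Towers of extensions\<close>

definition ktree_tower :: "nat \<Rightarrow> nat \<Rightarrow> (nat \<Rightarrow> 'a set) \<Rightarrow> (nat \<Rightarrow> 'a set set) \<Rightarrow> bool" where
  "ktree_tower k n V E \<longleftrightarrow> (\<forall>i j. i \<le> j \<longrightarrow> ktree_extension k (V i) (E i) (V j) (E j)) \<and>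
     (\<forall>i. \<forall>C\<subseteq>V i. card C = k \<longrightarrow> clique C (E i) \<longrightarrow>
       (\<exists>Y \<subseteq> V (Suc i) - V i. card Y = n \<and> (\<forall>y\<in>Y. \<forall>c\<in>C. {y, c} \<in> E (Suc i))))"

lemma ex_ktree_tower:
  fixes V :: "'a set"
  assumes inf: "infinite (UNIV :: 'a set)" and kt: "k_tree k V E"
  shows "\<exists>Vs Es. Vs 0 = V \<and> Es 0 = E \<and> ktree_tower k n Vs Es"
proof -
  define step where "step = (\<lambda>(V :: 'a set, E) (V', E'). ktree_extension k V E V' E' \<and>
    (\<forall>C\<subseteq>V. card C = k \<longrightarrow> clique C E \<longrightarrow>
      (\<exists>Y \<subseteq> V' - V. card Y = n \<and> (\<forall>y\<in>Y. \<forall>c\<in>C. {y, c} \<in> E'))))"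
  \<comment> \<open>The condition at \<open>i = 0\<close> pins the start of the sequence to
    \<open>(V, E)\<close>.\<close>
  have "\<exists>f. \<forall>i. (k_tree k (fst (f i)) (snd (f i)) \<and> (i = 0 \<longrightarrow> f i = (V, E))) \<and>
      step (f i) (f (Suc i))"
  proof (rule dependent_nat_choice)
    show "\<exists>x. k_tree k (fst x) (snd x) \<and> (0 = 0 \<longrightarrow> x = (V, E))" using kt by auto
  next
    fix x :: "'a set \<times> 'a set set" and i :: nat
    assume "k_tree k (fst x) (snd x) \<and> (i = 0 \<longrightarrow> x = (V, E))"
    then obtain V' E' where "step x (V', E')"
      using ktree_extension_all_children[OF inf, of k "fst x" "snd x" n]
      unfolding step_def by (auto simp: case_prod_beta)
    then show "\<exists>y. (k_tree k (fst y) (snd y) \<and> (Suc i = 0 \<longrightarrow> y = (V, E))) \<and> step x y"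
      by (intro exI[of _ "(V', E')"]) (auto simp: step_def ktree_extension_def)
  qed
  then obtain f where f: "\<And>i. k_tree k (fst (f i)) (snd (f i))" "f 0 = (V, E)"
      "\<And>i. step (f i) (f (Suc i))"
    by blast
  have "ktree_extension k (fst (f i)) (snd (f i)) (fst (f j)) (snd (f j))" if "i \<le> j" for i j
    using that
  proof (induction j rule: dec_induct)
    case base
    show ?case using f(1) by (rule ktree_extension_refl)
  next
    case (step j)
    then show ?case
      using f(3)[of j] unfolding step_def
      by (auto simp: case_prod_beta intro: ktree_extension_trans[OF step.IH])
  qed
  moreover have "\<exists>Y \<subseteq> fst (f (Suc i)) - fst (f i). card Y = n \<and>
      (\<forall>y\<in>Y. \<forall>c\<in>C. {y, c} \<in> snd (f (Suc i)))"
    if "C \<subseteq> fst (f i)" "card C = k" "clique C (snd (f i))" for i C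
    using f(3)[of i] that unfolding step_def by (auto simp: case_prod_beta)
  ultimately have "ktree_tower k n (fst \<circ> f) (snd \<circ> f)" by (simp add: ktree_tower_def)
  then show ?thesis
    using f(2) by (intro exI[of _ "fst \<circ> f"] exI[of _ "snd \<circ> f"]) auto
qed

section \<open>Transforming layouts\<close>

lemma local_queue_layout_mono:
  "local_queue_layout l V E lt P \<Longrightarrow> l \<le> l' \<Longrightarrow> local_queue_layout l' V E lt P"
  unfolding local_queue_layout_def by (meson order_trans)

text \<open>Reversal turns children on the left of a clique into children on the right, so only one
  side needs treatment.\<close>

lemma local_queue_layout_converse:
  assumes "local_queue_layout l V E lt P"
  shows "local_queue_layout l V E (lt\<inverse>) P"
proof -
  have conv: "nest (r\<inverse>) e f" if nst: "nest r e f" for r :: "'a rel" and e f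
  proof -
    obtain u v x y where ef: "e = {u, v}" "f = {x, y}"
      and *: "(u, x) \<in> r \<and> (x, y) \<in> r \<and> (y, v) \<in> r \<or> (x, u) \<in> r \<and> (u, v) \<in> r \<and> (v, y) \<in> r"
      using nst unfolding nest_def by blast
    \<comment> \<open>Reversal exchanges the roles of the two endpoints within each edge.\<close>
    have "e = {v, u}" "f = {y, x}" using ef by (simp_all add: insert_commute)
    note ** = this *
    show ?thesis
      unfolding nest_def converse_iff
      by (rule exI[of _ v], rule exI[of _ u], rule exI[of _ y], rule exI[of _ x]) (use ** in blast)
  qed
  have "queue (lt\<inverse>) Q" if "queue lt Q" for Q
    using that conv[of "lt\<inverse>"] unfolding queue_def converse_converse by metis
  moreover have "strict_linear_order_on V (lt\<inverse>)" if "strict_linear_order_on V lt"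
    using that unfolding strict_linear_order_on_def by simp
  ultimately show ?thesis
    using assms unfolding local_queue_layout_def queue_layout_def by simp
qed

text \<open>Every trace at a vertex comes from a queue at that vertex, so locality cannot grow.
  Empty traces are removed because blocks of a partition are nonempty.\<close>

lemma local_queue_layout_subgraph:
  assumes lay: "local_queue_layout l V' E' lt P" and sub: "V \<subseteq> V'" "E \<subseteq> E'" and fin: "finite E'"
  shows "local_queue_layout l V E lt ((\<inter>) E ` P - {{}})"
proof -
  let ?P = "(\<inter>) E ` P - {{}}"
  have P: "partition_on E' P" "\<And>Q. Q \<in> P \<Longrightarrow> queue lt Q" "strict_linear_order_on V' lt"
    using lay by (auto simp: local_queue_layout_def queue_layout_def)
  have finP: "finite P" using finite_elements[OF fin P(1)] .
  have "strict_linear_order_on V lt"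
    using P(3) sub(1) by (auto simp: strict_linear_order_on_def total_on_def)
  moreover have "partition_on E ?P"
  proof (rule partition_onI)
    show "\<Union> ?P = E"
    proof (intro equalityI subsetI)
      fix e assume "e \<in> E"
      then obtain Q where "Q \<in> P" "e \<in> E \<inter> Q" using partition_onD1[OF P(1)] sub(2) by blast
      then have "E \<inter> Q \<in> ?P" by blast
      with \<open>e \<in> E \<inter> Q\<close> show "e \<in> \<Union> ?P" by (rule UnionI[rotated])
    qed auto
    show "disjnt p q" if "p \<in> ?P" "q \<in> ?P" "p \<noteq> q" for p q
      using that partition_onD2[OF P(1)] by (auto simp: disjnt_def disjoint_def)
  qed auto
  moreover have "\<forall>Q\<in>?P. queue lt Q"
    using P(2) by (auto simp: queue_def)
  moreover have "int (card {Q \<in> ?P. \<exists>e\<in>Q. v \<in> e}) \<le> l" if "v \<in> V" for v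
  proof -
    have "{Q \<in> ?P. \<exists>e\<in>Q. v \<in> e} \<subseteq> (\<inter>) E ` {Q \<in> P. \<exists>e\<in>Q. v \<in> e}" by blast
    then have "card {Q \<in> ?P. \<exists>e\<in>Q. v \<in> e} \<le> card {Q \<in> P. \<exists>e\<in>Q. v \<in> e}"
      using finP by (intro surj_card_le) auto
    moreover have "int (card {Q \<in> P. \<exists>e\<in>Q. v \<in> e}) \<le> l"
      using lay that sub(1) by (auto simp: local_queue_layout_def)
    ultimately show ?thesis by linarith
  qed
  ultimately show ?thesis by (simp add: local_queue_layout_def queue_layout_def)
qed

text \<open>The colour of an edge is its queue. On non-edges the \<open>THE\<close> term has no
  intended value but still depends only on the unordered pair, so \<open>col_sym\<close> holds
  everywhere.\<close>

lemma edge_coloured_tower_of_layout: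
  assumes k: "k > 0" and tower: "ktree_tower k n V E" and n: "n > 2 * k ^ k"
    and lay: "local_queue_layout (int k) (V R) (E R) lt P"
  shows "edge_coloured_tower (\<lambda>x y. (x, y) \<in> lt) (\<lambda>x y. {x, y} \<in> E R)
    (\<lambda>x y. THE Q. Q \<in> P \<and> {x, y} \<in> Q) V k R"
proof -
  let ?col = "\<lambda>x y. THE Q. Q \<in> P \<and> {x, y} \<in> Q"
  have ext: "ktree_extension k (V i) (E i) (V j) (E j)" if "i \<le> j" for i j
    using tower that by (auto simp: ktree_tower_def)
  have sg: "finite (V R)" "E R \<subseteq> nsets (V R) 2"
    using ext[of R R] k_tree_simple_graph by (auto simp: ktree_extension_def simple_graph_def)
  have finE: "finite (E R)"
    using sg finite_imp_finite_nsets finite_subset by blast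
  have P: "partition_on (E R) P" "\<And>Q. Q \<in> P \<Longrightarrow> queue lt Q" "strict_linear_order_on (V R) lt"
    "\<And>v. v \<in> V R \<Longrightarrow> card {Q \<in> P. \<exists>e\<in>Q. v \<in> e} \<le> k"
    using lay by (auto simp: local_queue_layout_def queue_layout_def)
  have finP: "finite P" using finite_elements[OF finE P(1)] .
  have inV: "x \<in> V R" if "{x, y} \<in> E R" for x y
    using that sg(2) by (auto simp: nsets_def)
  have col: "?col x y \<in> P \<and> {x, y} \<in> ?col x y" if "{x, y} \<in> E R" for x y
  proof (rule theI')
    show "\<exists>!Q. Q \<in> P \<and> {x, y} \<in> Q"
      using partition_onD1[OF P(1)] partition_onD2[OF P(1)] that by (auto simp: disjoint_def)
  qed
  have colours: "{?col x y |y. {x, y} \<in> E R} \<subseteq> {Q \<in> P. \<exists>e\<in>Q. x \<in> e}" for x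
    using col by blast
  show ?thesis
  proof
    show "(x, y) \<in> lt \<Longrightarrow> (y, z) \<in> lt \<Longrightarrow> (x, z) \<in> lt" for x y z
      using P(3) by (auto simp: strict_linear_order_on_def dest: transD)
    show "(x, x) \<notin> lt" for x
      using P(3) by (auto simp: strict_linear_order_on_def irrefl_def)
    show "x \<in> V R \<Longrightarrow> y \<in> V R \<Longrightarrow> x \<noteq> y \<Longrightarrow> (x, y) \<in> lt \<or> (y, x) \<in> lt" for x y
      using P(3) by (auto simp: strict_linear_order_on_def total_on_def)
    show "{x, y} \<in> E R \<Longrightarrow> {y, x} \<in> E R" for x y by (simp add: insert_commute)
    show "{x, y} \<in> E R \<Longrightarrow> x \<in> V R" for x y by (rule inV)
    show "?col x y = ?col y x" for x y by (simp add: insert_commute)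
    show "?col u v \<noteq> ?col x y"
      if "{u, v} \<in> E R" "{x, y} \<in> E R" "(u, x) \<in> lt" "(x, y) \<in> lt" "(y, v) \<in> lt" for u v x y
    proof
      assume eq: "?col u v = ?col x y"
      have "nest lt {u, v} {x, y}" using that(3-5) unfolding nest_def by blast
      then show False
        using P(2) col[OF that(1)] col[OF that(2)] eq unfolding queue_def by metis
    qed
    show "finite {?col x y |y. {x, y} \<in> E R}" for x
      using finite_subset[OF colours] finP by simp
    show "card {?col x y |y. {x, y} \<in> E R} \<le> k" for x
    proof (cases "x \<in> V R")
      case True
      have "card {?col x y |y. {x, y} \<in> E R} \<le> card {Q \<in> P. \<exists>e\<in>Q. x \<in> e}"
        using finP by (intro card_mono colours) simp
      with P(4)[OF True] show ?thesis by linarith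
    next
      case False
      then have "{?col x y |y. {x, y} \<in> E R} = {}" using inV by blast
      then show ?thesis by (simp only: card.empty)
    qed
    show "V i \<subseteq> V j" if "i \<le> j" for i j
      using ext[OF that] by (auto simp: ktree_extension_def)
    show "\<exists>Y \<subseteq> V (Suc i) - V i. card Y > 2 * k ^ k \<and> (\<forall>y\<in>Y. \<forall>c\<in>C. {c, y} \<in> E R)"
      if i: "i < R" and C: "C \<subseteq> V i" "card C = k" "pairwise (\<lambda>x y. {x, y} \<in> E R) C" for i C
    proof -
      \<comment> \<open>Adjacency refers to the last graph, but \<open>V i\<close> induces
        \<open>E i\<close> there.\<close>
      have "clique C (E i)"
        unfolding clique_def
      proof (intro ballI impI)
        fix v w assume vw: "v \<in> C" "w \<in> C" "v \<noteq> w"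
        then have "{v, w} \<in> E R" using C(3) by (auto simp: pairwise_def)
        moreover have "{v, w} \<subseteq> V i" using vw C(1) by auto
        ultimately show "{v, w} \<in> E i"
          using ext[of i R] i by (auto simp: ktree_extension_def)
      qed
      then obtain Y where Y: "Y \<subseteq> V (Suc i) - V i" "card Y = n"
          "\<forall>y\<in>Y. \<forall>c\<in>C. {y, c} \<in> E (Suc i)"
        using tower C unfolding ktree_tower_def by blast
      moreover have "E (Suc i) \<subseteq> E R"
        using ext[of "Suc i" R] i by (auto simp: ktree_extension_def)
      ultimately show ?thesis
        using n by (intro exI[of _ Y]) (auto simp: insert_commute)
    qed
    show "k > 0" by fact
  qed
qed

section \<open>Children on one side of their parent clique\<close>

lemma ktree_construction_child:
  assumes "ktree_construction k V E cs" "(u, C) \<in> set cs"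
  shows "u \<in> V" "C \<subseteq> V" "u \<notin> C" "c \<in> C \<Longrightarrow> {c, u} \<in> E"
proof -
  have "u \<in> V \<and> C \<subseteq> V \<and> u \<notin> C \<and> (\<forall>c\<in>C. {c, u} \<in> E)"
    using assms
  proof (induction rule: ktree_construction.induct)
    case (add_vertex V E cs D v)
    then show ?case by (auto simp: insert_commute)
  qed simp
  then show "u \<in> V" "C \<subseteq> V" "u \<notin> C" "c \<in> C \<Longrightarrow> {c, u} \<in> E" by auto
qed

lemma few_right_children:
  assumes k: "k > 1" and tower: "ktree_tower k n V E" and n: "n > 2 * k ^ k"
    and R: "20 * (k * k + 1) \<le> R"
    and lay: "local_queue_layout (int k) (V R) (E R) lt P"
    and C: "C \<subseteq> V 0" "card C = k" "clique C (E 0)"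
    and U: "U \<subseteq> V 0" "\<And>u c. u \<in> U \<Longrightarrow> c \<in> C \<Longrightarrow> (c, u) \<in> lt \<and> {c, u} \<in> E 0"
  shows "card U \<le> 2 * k ^ k"
proof (rule ccontr)
  assume *: "\<not> ?thesis"
  interpret edge_coloured_tower "\<lambda>x y. (x, y) \<in> lt" "\<lambda>x y. {x, y} \<in> E R"
    "\<lambda>x y. THE Q. Q \<in> P \<and> {x, y} \<in> Q" V k R
    using k by (intro edge_coloured_tower_of_layout[OF _ tower n lay]) simp
  have "E 0 \<subseteq> E R" using tower by (auto simp: ktree_tower_def ktree_extension_def)
  then show False
    using * C U k by (intro many_right_children_False[OF k R C(1,2) _ U(1)])
      (auto simp: pairwise_def clique_def)
qed

theorem lemma10:
  fixes k :: nat and l :: int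
  assumes "k > 1" and "l \<le> int k"
    and "\<And>s::nat. s > 0 \<Longrightarrow>
      \<exists>(V :: nat set) E cs. ktree_construction k V E cs \<and>
        (\<forall>lt P. local_queue_layout l V E lt P \<longrightarrow>
          (\<exists>C\<subseteq>V. card C = k \<and> clique C E \<and> card (nonnesting_children lt cs C) \<ge> s))"
  shows "\<exists>(V :: nat set) E. k_tree k V E \<and> int (local_queue_number V E) \<ge> l + 1"
proof -
  \<comment> \<open>A layout of the extended tree would allow at most \<open>2 * k ^ k\<close>
    children on either side of a clique.\<close>
  define s where "s = 4 * k ^ k + 1"
  then have "s > 0" by simp
  from assms(3)[OF this] obtain V :: "nat set" and E cs where cons: "ktree_construction k V E cs"
    and many: "\<forall>lt P. local_queue_layout l V E lt P \<longrightarrow>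
          (\<exists>C\<subseteq>V. card C = k \<and> clique C E \<and> card (nonnesting_children lt cs C) \<ge> s)"
    by blast
  define R where "R = 20 * (k * k + 1)"
  define n where "n = 2 * k ^ k + 1"
  have "k_tree k V E" using cons by (auto simp: k_tree_def)
  from ex_ktree_tower[OF infinite_UNIV_nat this, of n]
  obtain Vs Es where T: "Vs 0 = V" "Es 0 = E" "ktree_tower k n Vs Es" by blast
  have ext: "ktree_extension k V E (Vs R) (Es R)"
    using T by (auto simp: ktree_tower_def)
  then have kt: "k_tree k (Vs R) (Es R)" by (simp add: ktree_extension_def)
  then have sg: "simple_graph (Vs R) (Es R)" by (rule k_tree_simple_graph)
  have no_layout: "\<not> local_queue_layout l (Vs R) (Es R) lt P" for lt P
  proof
    assume lay: "local_queue_layout l (Vs R) (Es R) lt P"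
    have finE: "finite (Es R)"
      using sg finite_imp_finite_nsets finite_subset by (auto simp: simple_graph_def)
    have sub: "V \<subseteq> Vs R" "E \<subseteq> Es R" using ext by (auto simp: ktree_extension_def)
    \<comment> \<open>Restricting the layout to the hypothesis tree supplies the clique.\<close>
    obtain C where C: "C \<subseteq> V" "card C = k" "clique C E" "card (nonnesting_children lt cs C) \<ge> s"
      using many local_queue_layout_subgraph[OF lay sub finE] by blast
    define U where "U = nonnesting_children lt cs C"
    have child: "u \<in> V" "u \<notin> C" "c \<in> C \<Longrightarrow> {c, u} \<in> E" "\<not> nesting lt C u" if "u \<in> U" for u c
      using that ktree_construction_child[OF cons]
      by (auto simp: U_def nonnesting_children_def children_def)
    define A where "A = {u \<in> U. \<forall>c\<in>C. (c, u) \<in> lt}"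
    define B where "B = {u \<in> U. \<forall>c\<in>C. (u, c) \<in> lt}"
    have "total_on (Vs R) lt"
      using lay by (auto simp: local_queue_layout_def queue_layout_def strict_linear_order_on_def)
    moreover have "V \<subseteq> Vs R" using ext by (simp add: ktree_extension_def)
    ultimately have total: "(c, u) \<in> lt \<or> (u, c) \<in> lt" if "u \<in> U" "c \<in> C" for u c
      using child(1,2)[OF that(1)] that C(1) unfolding total_on_def by (metis subsetD)
    have "U \<subseteq> A \<union> B"
      using total child(4) unfolding A_def B_def nesting_def by blast
    moreover have "finite U"
      using C(4) by (intro card_ge_0_finite) (simp add: U_def s_def)
    ultimately have "card U \<le> card A + card B"
      using card_Un_le[of A B] card_mono[of "A \<union> B" U] by (force simp: A_def B_def)
    \<comment> \<open>With \<open>k\<close> colours per vertex, a node sees exactly as many colours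
      as it has parents, as the tower argument requires.\<close>
    moreover have layk: "local_queue_layout (int k) (Vs R) (Es R) lt P"
      using local_queue_layout_mono[OF lay assms(2)] .
    have "card A \<le> 2 * k ^ k"
      using C child T
      by (intro few_right_children[OF assms(1) T(3) _ _ layk]) (auto simp: n_def R_def A_def)
    moreover have "card B \<le> 2 * k ^ k"
      using C child T
      by (intro few_right_children[OF assms(1) T(3) _ _ local_queue_layout_converse[OF layk]])
        (auto simp: n_def R_def B_def)
    ultimately show False using C(4) by (simp add: U_def s_def)
  qed
  \<comment> \<open>The minimum is attained, so a local queue number of at most \<open>l\<close>
    would yield an \<open>l\<close>-local layout.\<close>
  have "\<exists>lt P. local_queue_layout (int (local_queue_number (Vs R) (Es R))) (Vs R) (Es R) lt P"
    unfolding local_queue_number_def by (rule LeastI_ex) (rule ex_local_queue_layout[OF sg])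
  then have "\<not> int (local_queue_number (Vs R) (Es R)) \<le> l"
    using no_layout local_queue_layout_mono by blast
  with kt show ?thesis by (intro exI[of _ "Vs R"] exI[of _ "Es R"]) simp
qed

end
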